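(* Let $1\leq p<2$, and let $\mathbf{A}=(A_{ij})$ be a real $N\times N$ matrix of rank $d$ all of whose diagonal entries are equal to $1$. Then $$E_p(\mathbf{A})\;\geq\; \frac{2(N-d)}{p^{\frac p2}\,(2-p)^{\frac{2-p}{2}}}.$$
   Context: For a real $N\times N$ matrix $\mathbf{A}=(A_{ij})$ and $p>0$, the $p$-frame energy is $E_p(\mathbf{A})=\sum_{i\neq j}|A_{ij}|^p$, the sum running over all ordered pairs $(i,j)$ with $1\le i,j\le N$, $i\neq j$. The matrix $\mathbf{A}$ is not assumed symmetric or positive semidefinite. *)

theory Defs
  imports "HOL-Analysis.Analysis"
begin

text \<open>
  An \<open>N \<times> N\<close> real matrix is an element of \<^typ>\<open>real ^ 'n ^ 'n\<close> with \<open>N = CARD('n)\<close>.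
  For \<open>p > 0\<close> a vanishing entry contributes \<open>0\<close>, since \<open>0 powr p = 0\<close>.
\<close>

definition frame_energy :: "real \<Rightarrow> real ^ 'n ^ 'n \<Rightarrow> real" where
  "frame_energy p A = (\<Sum>(i, j) \<in> {(i, j). i \<noteq> j}. \<bar>A $ i $ j\<bar> powr p)"

end

theory Submission
  imports Defs
begin

text \<open>
  Let \<open>K\<close> be the kernel of \<open>A\<close>, of dimension \<open>N - d\<close>, and let \<open>v\<^sub>i\<close> be the orthogonal projection of
  the \<open>i\<close>-th coordinate vector to \<open>K\<close>.  Its \<open>i\<close>-th coordinate \<open>x\<^sub>i\<close> equals its squared norm, and the
  \<open>x\<^sub>i\<close> are the diagonal entries of a projection matrix, so they sum to the trace \<open>N - d\<close>.
  It therefore suffices to bound the contribution of each single row of \<open>A\<close> from below by a constant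
  times \<open>x\<^sub>i\<close>.

  Row \<open>i\<close> is orthogonal to \<open>v\<^sub>i\<close> and has the entry \<open>1\<close> in position \<open>i\<close>, so the remaining entries have
  to cancel \<open>x\<^sub>i\<close>, although the remaining part of \<open>v\<^sub>i\<close> has squared norm only \<open>x\<^sub>i - x\<^sub>i\<^sup>2\<close>.
  By Cauchy-Schwarz the squares of these entries sum to at least \<open>x\<^sub>i / (1 - x\<^sub>i)\<close>
  (\<open>offdiagonal_square_sum_bound\<close>), and for exponents below \<open>2\<close> the sum of \<open>p\<close>-th powers dominates
  the \<open>p/2\<close>-th power of the sum of squares (\<open>sum_squares_powr_le\<close>).  Finally
  \<open>(x / (1 - x)) powr (p/2)\<close> lies above the line through the origin whose slope is the constant of
  the theorem (\<open>odds_powr_ge_linear\<close>); this is the weighted inequality of arithmetic and geometric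
  means, and the line touches at \<open>x = 1 - p/2\<close>.
\<close>

section \<open>Scalar inequalities\<close>

text \<open>
  Monotonicity of the \<open>l\<^sup>q\<close> norms in \<open>q\<close>, for \<open>q = 2 * a \<le> 2\<close>: each \<open>q\<close>-th power is at most the whole
  sum \<open>S\<close>, so a square exceeds its \<open>q\<close>-th power by at most a factor of \<open>S powr (1/a - 1)\<close>.
\<close>

lemma sum_squares_powr_le:
  fixes f :: "'a \<Rightarrow> real"
  assumes "0 < a" "a \<le> 1" "finite J"
  shows "(\<Sum>j\<in>J. (f j)\<^sup>2) powr a \<le> (\<Sum>j\<in>J. \<bar>f j\<bar> powr (2 * a))"
proof -
  define S where "S = (\<Sum>j\<in>J. \<bar>f j\<bar> powr (2 * a))"
  have S0: "S \<ge> 0"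
    unfolding S_def by (intro sum_nonneg) auto
  have square: "(f j)\<^sup>2 \<le> S powr (1/a - 1) * \<bar>f j\<bar> powr (2 * a)" if "j \<in> J" for j
  proof -
    have "\<bar>f j\<bar> powr (2 * a) \<le> S"
      unfolding S_def using that assms(3) by (intro member_le_sum) auto
    then have "(\<bar>f j\<bar> powr (2 * a)) powr (1/a - 1) \<le> S powr (1/a - 1)"
      using assms by (intro powr_mono2) (auto simp: field_simps)
    moreover have "(f j)\<^sup>2 = (\<bar>f j\<bar> powr (2 * a)) powr (1/a - 1) * \<bar>f j\<bar> powr (2 * a)"
    proof (cases "f j = 0")
      case False
      have "2 * a * (1/a - 1) + 2 * a = 2"
        using assms by (simp add: field_simps)
      then show ?thesis
        using False by (simp add: powr_powr flip: powr_add)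
    qed auto
    ultimately show ?thesis
      by (simp add: mult_right_mono)
  qed
  have "(\<Sum>j\<in>J. (f j)\<^sup>2) \<le> S powr (1/a - 1) * S"
    unfolding S_def sum_distrib_left using square by (intro sum_mono) (simp add: S_def)
  also have "\<dots> = S powr (1/a)"
    using S0 by (cases "S = 0") (auto simp: powr_diff)
  finally have "(\<Sum>j\<in>J. (f j)\<^sup>2) powr a \<le> (S powr (1/a)) powr a"
    using assms by (intro powr_mono2) (auto intro: sum_nonneg)
  also have "\<dots> = S"
    using assms S0 by (simp add: powr_powr)
  finally show ?thesis
    by (simp add: S_def)
qed

text \<open>
  After clearing denominators this is the weighted inequality of arithmetic and geometric means for
  the numbers \<open>(1 - x) / a\<close> and \<open>x / (1 - a)\<close> with weights \<open>a\<close> and \<open>1 - a\<close>, whose weighted mean is \<open>1\<close>.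
\<close>

lemma odds_powr_ge_linear:
  fixes a x :: real
  assumes "0 < a" "a < 1" "0 < x" "x < 1"
  shows "x / (a powr a * (1 - a) powr (1 - a)) \<le> (x / (1 - x)) powr a"
proof -
  have "((1 - x) / a) powr a * (x / (1 - a)) powr (1 - a)
      \<le> a * ((1 - x) / a) + (1 - a) * (x / (1 - a))"
    using assms by (intro Youngs_inequality_0) auto
  also have "\<dots> = 1"
    using assms by simp
  finally have "(1 - x) powr a * x powr (1 - a) \<le> a powr a * (1 - a) powr (1 - a)"
    using assms by (simp add: powr_divide field_simps)
  then show ?thesis
    using assms by (simp add: powr_divide powr_diff field_simps)
qed

section \<open>One row of the matrix\<close>

text \<open>
  The hypothesis \<open>v $ i = v \<bullet> v\<close> says how \<open>v\<close> enters: it holds exactly when the \<open>i\<close>-th coordinate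
  vector minus \<open>v\<close> is orthogonal to \<open>v\<close>, as for a projection of that vector to a subspace.
\<close>

lemma offdiagonal_square_sum_bound:
  fixes u v :: "real ^ 'n"
  assumes "u $ i = 1" "u \<bullet> v = 0" "v $ i = v \<bullet> v" "v \<noteq> 0"
  shows "v $ i < 1" and "v $ i / (1 - v $ i) \<le> (\<Sum>j\<in>-{i}. (u $ j)\<^sup>2)"
proof -
  define x where "x = v $ i"
  define T where "T = (\<Sum>j\<in>-{i}. (u $ j)\<^sup>2)"
  have split: "(\<Sum>j\<in>UNIV. g j) = g i + (\<Sum>j\<in>-{i}. g j)" for g :: "'n \<Rightarrow> real"
    by (simp add: Compl_eq_Diff_UNIV sum.remove)
  have x: "x > 0"
    using assms by (simp add: x_def)
  have "(\<Sum>j\<in>-{i}. u $ j * v $ j) = - x"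
    using assms(1,2) split[of "\<lambda>j. u $ j * v $ j"] by (simp add: inner_vec_def x_def)
  moreover have "(\<Sum>j\<in>-{i}. (v $ j)\<^sup>2) = x * (1 - x)"
    using assms(3) split[of "\<lambda>j. (v $ j)\<^sup>2"]
    by (simp add: inner_vec_def x_def power2_eq_square algebra_simps)
  ultimately have "x\<^sup>2 \<le> T * (x * (1 - x))"
    using Cauchy_Schwarz_ineq_sum[of "\<lambda>j. u $ j" "\<lambda>j. v $ j" "-{i}"] by (simp add: T_def)
  then have le: "x \<le> T * (1 - x)"
    using x by (simp add: power2_eq_square)
  have "T \<ge> 0"
    unfolding T_def by (intro sum_nonneg) auto
  then have "x < 1"
    using le x by (smt (verit) mult_nonneg_nonpos)
  then show "v $ i < 1" and "v $ i / (1 - v $ i) \<le> (\<Sum>j\<in>-{i}. (u $ j)\<^sup>2)"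
    using le by (simp_all add: x_def T_def field_simps)
qed

lemma offdiagonal_powr_sum_bound:
  fixes u v :: "real ^ 'n"
  assumes "0 < a" "a < 1" "u $ i = 1" "u \<bullet> v = 0" "v $ i = v \<bullet> v"
  shows "v $ i / (a powr a * (1 - a) powr (1 - a)) \<le> (\<Sum>j\<in>-{i}. \<bar>u $ j\<bar> powr (2 * a))"
proof (cases "v = 0")
  case True
  then show ?thesis
    by (auto intro: sum_nonneg)
next
  case False
  note bound = offdiagonal_square_sum_bound[OF assms(3-5) False]
  have pos: "0 < v $ i"
    using assms(5) False by simp
  have "v $ i / (a powr a * (1 - a) powr (1 - a)) \<le> (v $ i / (1 - v $ i)) powr a"
    using assms(1,2) pos bound(1) by (rule odds_powr_ge_linear)
  also have "\<dots> \<le> (\<Sum>j\<in>-{i}. (u $ j)\<^sup>2) powr a"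
    using assms(1) pos bound by (intro powr_mono2) auto
  also have "\<dots> \<le> (\<Sum>j\<in>-{i}. \<bar>u $ j\<bar> powr (2 * a))"
    using assms(1,2) by (intro sum_squares_powr_le) auto
  finally show ?thesis .
qed

section \<open>Projections of the coordinate vectors to the kernel\<close>

text \<open>
  The vectors are the columns of the orthogonal projection matrix to \<open>S\<close>, written as
  \<open>\<Sum>b\<in>B. (b $ i) *\<^sub>R b\<close> in an orthonormal basis \<open>B\<close>; the last part is the fact that the trace of a
  projection is its rank.
\<close>

lemma coordinate_projections:
  fixes S :: "(real ^ 'n) set"
  assumes "subspace S"
  obtains v :: "'n \<Rightarrow> real ^ 'n"
  where "\<And>i. v i \<in> S" "\<And>i. v i $ i = v i \<bullet> v i" "(\<Sum>i\<in>UNIV. v i $ i) = real (dim S)"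
proof -
  obtain B where B: "B \<subseteq> S" "pairwise orthogonal B" "\<And>b. b \<in> B \<Longrightarrow> norm b = 1"
      "independent B" "card B = dim S"
    using orthonormal_basis_subspace[OF assms] by metis
  have fin: "finite B"
    using B(4) by (rule independent_imp_finite)
  have orthonormal: "b \<bullet> c = (if b = c then 1 else 0)" if "b \<in> B" "c \<in> B" for b c
    using B(2,3) that by (auto simp: pairwise_def orthogonal_def norm_eq_1)
  define v where "v i = (\<Sum>b\<in>B. (b $ i) *\<^sub>R b)" for i :: 'n
  have diag: "v i $ i = (\<Sum>b\<in>B. (b $ i)\<^sup>2)" for i
    by (simp add: v_def power2_eq_square)
  show thesis
  proof
    show "v i \<in> S" for i
      unfolding v_def using B(1) assms by (intro subspace_sum subspace_scale) auto
    show "v i $ i = v i \<bullet> v i" for i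
    proof -
      have "v i \<bullet> v i = (\<Sum>b\<in>B. b $ i * (\<Sum>c\<in>B. c $ i * (b \<bullet> c)))"
        by (simp add: v_def inner_sum_left inner_sum_right sum_distrib_left mult.left_commute inner_commute)
      also have "\<dots> = (\<Sum>b\<in>B. (b $ i)\<^sup>2)"
        using fin by (intro sum.cong) (simp_all add: orthonormal power2_eq_square if_distrib cong: if_cong)
      finally show ?thesis
        by (simp add: diag)
    qed
    have "(\<Sum>i\<in>UNIV. v i $ i) = (\<Sum>b\<in>B. b \<bullet> b)"
      unfolding diag by (subst sum.swap) (simp add: inner_vec_def power2_eq_square)
    also have "\<dots> = real (dim S)"
      using B(5) by (simp add: orthonormal)
    finally show "(\<Sum>i\<in>UNIV. v i $ i) = real (dim S)" .
  qed
qed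

lemma rank_plus_dim_kernel:
  fixes A :: "real ^ 'n ^ 'm"
  shows "dim {x. A *v x = 0} + rank A = CARD('n)"
proof -
  have "{x. A *v x = 0} = {x \<in> UNIV. \<forall>y\<in>span (rows A). orthogonal y x}"
  proof (intro set_eqI iffI)
    fix x assume "x \<in> {x. A *v x = 0}"
    then show "x \<in> {x \<in> UNIV. \<forall>y\<in>span (rows A). orthogonal y x}"
      using orthogonal_nullspace_rowspace[of A x] by (simp add: orthogonal_commute)
  next
    fix x assume "x \<in> {x \<in> UNIV. \<forall>y\<in>span (rows A). orthogonal y x}"
    then have "A $ i \<bullet> x = 0" for i
      by (auto simp: orthogonal_def rows_def row_def intro!: span_base)
    then show "x \<in> {x. A *v x = 0}"
      by (simp add: vec_eq_iff matrix_vector_mul_component)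
  qed
  then show ?thesis
    using dim_subspace_orthogonal_to_vectors[of "span (rows A)" UNIV]
    by (simp add: row_rank_def)
qed

section \<open>The energy bound\<close>

lemma frame_energy_row_sums:
  fixes A :: "real ^ 'n ^ 'n"
  shows "frame_energy p A = (\<Sum>i\<in>UNIV. \<Sum>j\<in>-{i}. \<bar>A $ i $ j\<bar> powr p)"
proof -
  have "{(i, j). i \<noteq> j} = Sigma UNIV (\<lambda>i::'n. -{i})"
    by auto
  then show ?thesis
    by (simp add: frame_energy_def sum.Sigma)
qed

theorem theorem3p1:
  fixes A :: "real ^ 'n ^ 'n" and p :: real and N d :: nat
  assumes "1 \<le> p" and "p < 2"
    and "CARD('n) = N"
    and "rank A = d"
    and "\<And>i. A $ i $ i = 1"
  shows "frame_energy p A \<ge> 2 * (real N - real d) / (p powr (p / 2) * (2 - p) powr ((2 - p) / 2))"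
proof -
  let ?K = "{x. A *v x = 0}"
  define a where "a = p / 2"
  have a: "0 < a" "a < 1" and p: "p = 2 * a"
    using assms(1,2) by (auto simp: a_def)
  have "subspace ?K"
    by (auto simp: subspace_def matrix_vector_right_distrib matrix_vector_mult_scaleR)
  then obtain v where v: "\<And>i. v i \<in> ?K" "\<And>i. v i $ i = v i \<bullet> v i"
      "(\<Sum>i\<in>UNIV. v i $ i) = real (dim ?K)"
    using coordinate_projections by blast
  have "(2 * a) powr a * (2 * (1 - a)) powr (1 - a)
      = (2 powr a * 2 powr (1 - a)) * (a powr a * (1 - a) powr (1 - a))"
    using a by (simp only: powr_mult ac_simps)
  also have "2 powr a * 2 powr (1 - a) = (2 :: real)"
    by (simp flip: powr_add)
  finally have const: "p powr (p / 2) * (2 - p) powr ((2 - p) / 2)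
      = 2 * (a powr a * (1 - a) powr (1 - a))"
    by (simp add: p diff_divide_distrib right_diff_distrib)
  have "real (dim ?K) = real N - real d"
    using rank_plus_dim_kernel[of A] assms(3,4) by linarith
  then have "2 * (real N - real d) / (p powr (p / 2) * (2 - p) powr ((2 - p) / 2))
      = (\<Sum>i\<in>UNIV. v i $ i) / (a powr a * (1 - a) powr (1 - a))"
    unfolding const v(3) by (simp only: mult_divide_mult_cancel_left_if) simp
  also have "\<dots> = (\<Sum>i\<in>UNIV. v i $ i / (a powr a * (1 - a) powr (1 - a)))"
    by (rule sum_divide_distrib)
  also have "\<dots> \<le> (\<Sum>i\<in>UNIV. \<Sum>j\<in>-{i}. \<bar>A $ i $ j\<bar> powr (2 * a))"
  proof (rule sum_mono)
    fix i
    have "A $ i \<bullet> v i = 0"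
      using v(1)[of i] by (simp add: vec_eq_iff matrix_vector_mul_component)
    then show "v i $ i / (a powr a * (1 - a) powr (1 - a)) \<le> (\<Sum>j\<in>-{i}. \<bar>A $ i $ j\<bar> powr (2 * a))"
      using a assms(5) v(2) by (intro offdiagonal_powr_sum_bound) auto
  qed
  also have "\<dots> = frame_energy p A"
    by (simp add: frame_energy_row_sums p)
  finally show ?thesis .
qed

end
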